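(* Let $q$ be a unimodular complex number, let $V_1$ and $V_2$ be isometries on a Hilbert space $\mathcal H$ such that $V=V_1V_2$ is a shift, and let $\mathfrak r_q$ and $\mathfrak r_{\overline q}$ be the unitaries on $\mathcal H$ associated with $(V_1,V_2)$. Then: (1) $(V_1,V_2)$ is doubly commutative if and only if $(V_1\mathfrak r_q,\mathfrak r_{\overline q} V_2)$ is doubly $q$-commutative; (2) $(V_1,V_2)$ is doubly $q$-commutative if and only if $(V_1\mathfrak r_{\overline q},\mathfrak r_{q} V_2)$ is doubly commutative.
   Context: A pair $(A,B)$ of operators is $q$-commutative if $AB=qBA$, and doubly $q$-commutative if in addition $BA^*=qA^*B$. It is doubly commutative if $AB=BA$ and $BA^*=A^*B$ (the case $q=1$). A shift is an isometry $S$ with $S^{*n}\to0$ in the strong operator topology. For a contraction $T$, $D_{T^*}=(I-TT^* )^{1/2}$ and $\mathcal D_{T^*}=\overline{\operatorname{Ran}}\,D_{T^*}$. $H^2$ is the Hardy space of the unit disk and, for unimodular $q$, $R_q$ is the unitary $f(z)\mapsto f(qz)$ on $H^2$, acting in the same way on vector-valued $H^2(\mathcal F)=H^2\otimes\mathcal F$ (i.e. as $R_q\otimes I_{\mathcal F}$). For isometries $V_1,V_2$ on $\mathcal H$ with $V=V_1V_2$ a shift, put $\mathcal F=\mathcal D_{V_1^*}\oplus\mathcal D_{V_2^*}$ and let $\tau_{\rm BCL}:\mathcal H\to H^2(\mathcal F)$ be the unitary $$\tau_{\rm BCL}h=\sum_{n\ge0}z^n\left(D_{V_1^*}V^{*n}h\oplus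 D_{V_2^*}V_1^*V^{*n}h\right).$$ The unitary $\mathfrak r_q$ is defined by $\mathfrak r_q:=\tau_{\rm BCL}^*R_q\tau_{\rm BCL}:\mathcal H\to\mathcal H$, and $\mathfrak r_{\overline q}:=\tau_{\rm BCL}^*R_{\overline q}\tau_{\rm BCL}$; explicitly, $\mathfrak r_qh=\sum_{n\ge0}q^nV^nD_{V^*}V^{*n}h$. *)

theory Defs
  imports "HOL-Analysis.Analysis"
begin

section \<open>Complex Hilbert spaces\<close>

class complex_vector = real_vector +
  fixes scaleC :: "complex \<Rightarrow> 'a \<Rightarrow> 'a" (infixr "*\<^sub>C" 75)
  assumes scaleC_add_right: "a *\<^sub>C (x + y) = a *\<^sub>C x + a *\<^sub>C y"
    and scaleC_add_left: "(a + b) *\<^sub>C x = a *\<^sub>C x + b *\<^sub>C x"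
    and scaleC_scaleC: "a *\<^sub>C b *\<^sub>C x = (a * b) *\<^sub>C x"
    and scaleC_of_real: "complex_of_real r *\<^sub>C x = r *\<^sub>R x"

text \<open>
  The complex inner product is linear in its first argument. Its real part is the
  \<^const>\<open>inner\<close> of \<^class>\<open>real_inner\<close>, whence
  \<open>cinner x x = (norm x)\<^sup>2\<close>; positivity and definiteness are inherited.
\<close>

class complex_inner = complex_vector + real_inner +
  fixes cinner :: "'a \<Rightarrow> 'a \<Rightarrow> complex"
  assumes cinner_commute: "cinner x y = cnj (cinner y x)"
    and cinner_add_left: "cinner (x + y) z = cinner x z + cinner y z"
    and cinner_scaleC_left: "cinner (a *\<^sub>C x) y = a * cinner x y"
    and Re_cinner: "Re (cinner x y) = inner x y"

class chilbert_space = complex_inner + complete_space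

lemma cinner_self:
  fixes x :: "'a::complex_inner"
  shows "cinner x x = complex_of_real ((norm x)\<^sup>2)"
proof (rule complex_eqI)
  show "Re (cinner x x) = Re (complex_of_real ((norm x)\<^sup>2))"
    by (simp add: Re_cinner power2_norm_eq_inner)
  have "Im (cinner x x) = - Im (cinner x x)"
    using cinner_commute[of x x] by (metis cnj.simps(2))
  then show "Im (cinner x x) = Im (complex_of_real ((norm x)\<^sup>2))"
    by simp
qed

instantiation complex :: chilbert_space
begin

definition scaleC_complex_def: "a *\<^sub>C (x::complex) = a * x"
definition cinner_complex_def: "cinner (x::complex) y = x * cnj y"

instance
  by standard
    (auto simp: scaleC_complex_def cinner_complex_def inner_complex_def algebra_simps
      scaleR_conv_of_real)

end

text \<open>The Hilbert space direct sum of two Hilbert spaces is the product type.\<close>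

instantiation prod :: (complex_vector, complex_vector) complex_vector
begin

definition scaleC_prod_def: "a *\<^sub>C x = (a *\<^sub>C fst x, a *\<^sub>C snd x)"

instance
  by standard
    (auto simp: scaleC_prod_def scaleC_add_right scaleC_add_left scaleC_scaleC
      scaleC_of_real prod_eq_iff)

end

instantiation prod :: (complex_inner, complex_inner) complex_inner
begin

definition cinner_prod_def:
  "cinner x y = cinner (fst x) (fst y) + cinner (snd x) (snd y)"

instance
proof
  fix x y z :: "'a \<times> 'b" and a :: complex
  show "cinner x y = cnj (cinner y x)"
    unfolding cinner_prod_def complex_cnj_add
    by (subst (1 2) cinner_commute) simp
  show "cinner (x + y) z = cinner x z + cinner y z"
    by (simp add: cinner_prod_def cinner_add_left)
  show "cinner (a *\<^sub>C x) y = a * cinner x y"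
    by (simp add: cinner_prod_def scaleC_prod_def cinner_scaleC_left distrib_left)
  show "Re (cinner x y) = inner x y"
    by (simp add: cinner_prod_def Re_cinner inner_prod_def)
qed

end

instance prod :: (chilbert_space, chilbert_space) chilbert_space ..


section \<open>Operators\<close>

definition bounded_clinear :: "('a::chilbert_space \<Rightarrow> 'b::chilbert_space) \<Rightarrow> bool" where
  "bounded_clinear T \<longleftrightarrow> bounded_linear T \<and> (\<forall>c x. T (c *\<^sub>C x) = c *\<^sub>C T x)"

text \<open>Only meaningful for bounded operators, for which the adjoint exists.\<close>

definition cadj :: "('a::chilbert_space \<Rightarrow> 'b::chilbert_space) \<Rightarrow> 'b \<Rightarrow> 'a" where
  "cadj T y = (THE x'. \<forall>x. cinner (T x) y = cinner x x')"

definition is_isometry :: "('a::chilbert_space \<Rightarrow> 'b::chilbert_space) \<Rightarrow> bool" where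
  "is_isometry T \<longleftrightarrow> bounded_clinear T \<and> (\<forall>x. norm (T x) = norm x)"

definition is_shift :: "('a::chilbert_space \<Rightarrow> 'a) \<Rightarrow> bool" where
  "is_shift S \<longleftrightarrow> is_isometry S \<and> (\<forall>x. (\<lambda>n. (cadj S ^^ n) x) \<longlonglongrightarrow> 0)"

definition positive_operator :: "('a::chilbert_space \<Rightarrow> 'a) \<Rightarrow> bool" where
  "positive_operator T \<longleftrightarrow> bounded_clinear T \<and> (\<forall>x. cinner (T x) x \<in> \<real>\<^sub>\<ge>\<^sub>0)"

definition operator_sqrt :: "('a::chilbert_space \<Rightarrow> 'a) \<Rightarrow> 'a \<Rightarrow> 'a" where
  "operator_sqrt A = (THE P. positive_operator P \<and> P \<circ> P = A)"

text \<open>The defect operator and defect space of the \<^emph>\<open>adjoint\<close> of the contraction \<open>T\<close>.\<close>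

definition defect_adj :: "('a::chilbert_space \<Rightarrow> 'a) \<Rightarrow> 'a \<Rightarrow> 'a" where
  "defect_adj T = operator_sqrt (\<lambda>x. x - T (cadj T x))"

definition defect_space_adj :: "('a::chilbert_space \<Rightarrow> 'a) \<Rightarrow> 'a set" where
  "defect_space_adj T = closure (range (defect_adj T))"

definition doubly_commutative :: "('a::chilbert_space \<Rightarrow> 'a) \<Rightarrow> ('a \<Rightarrow> 'a) \<Rightarrow> bool" where
  "doubly_commutative A B \<longleftrightarrow> A \<circ> B = B \<circ> A \<and> B \<circ> cadj A = cadj A \<circ> B"

definition q_commutative :: "complex \<Rightarrow> ('a::chilbert_space \<Rightarrow> 'a) \<Rightarrow> ('a \<Rightarrow> 'a) \<Rightarrow> bool" where
  "q_commutative q A B \<longleftrightarrow> (\<forall>x. A (B x) = q *\<^sub>C B (A x))"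

definition doubly_q_commutative ::
    "complex \<Rightarrow> ('a::chilbert_space \<Rightarrow> 'a) \<Rightarrow> ('a \<Rightarrow> 'a) \<Rightarrow> bool" where
  "doubly_q_commutative q A B \<longleftrightarrow>
     q_commutative q A B \<and> (\<forall>x. B (cadj A x) = q *\<^sub>C cadj A (B x))"


section \<open>Vector-valued Hardy space\<close>

definition has_taylor :: "(complex \<Rightarrow> 'b::chilbert_space) \<Rightarrow> (nat \<Rightarrow> 'b) \<Rightarrow> bool" where
  "has_taylor f a \<longleftrightarrow> (\<forall>z\<in>ball 0 1. (\<lambda>n. z ^ n *\<^sub>C a n) sums f z)"

text \<open>
  \<open>hardy_space F\<close> is \<open>H\<^sup>2(F)\<close> for a closed subspace \<open>F\<close>. Functions on the open unit
  disk are represented by total functions vanishing outside it.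
\<close>

definition hardy_space :: "'b::chilbert_space set \<Rightarrow> (complex \<Rightarrow> 'b) set" where
  "hardy_space F =
     {f. (\<forall>z. z \<notin> ball 0 1 \<longrightarrow> f z = 0) \<and>
         (\<exists>a. range a \<subseteq> F \<and> summable (\<lambda>n. (norm (a n))\<^sup>2) \<and> has_taylor f a)}"

definition hardy_coeff :: "(complex \<Rightarrow> 'b::chilbert_space) \<Rightarrow> nat \<Rightarrow> 'b" where
  "hardy_coeff f = (THE a. has_taylor f a)"

definition hardy_cinner ::
    "(complex \<Rightarrow> 'b::chilbert_space) \<Rightarrow> (complex \<Rightarrow> 'b) \<Rightarrow> complex" where
  "hardy_cinner f g = (\<Sum>n. cinner (hardy_coeff f n) (hardy_coeff g n))"

definition hardy_rot ::
    "complex \<Rightarrow> 'b::chilbert_space set \<Rightarrow> (complex \<Rightarrow> 'b) \<Rightarrow> complex \<Rightarrow> 'b" where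
  "hardy_rot q F = (\<lambda>f\<in>hardy_space F. \<lambda>z. f (q * z))"


section \<open>The unitary associated with a pair of isometries\<close>

definition BCL_space ::
    "('a::chilbert_space \<Rightarrow> 'a) \<Rightarrow> ('a \<Rightarrow> 'a) \<Rightarrow> ('a \<times> 'a) set" where
  "BCL_space V1 V2 = defect_space_adj V1 \<times> defect_space_adj V2"

definition tau_BCL ::
    "('a::chilbert_space \<Rightarrow> 'a) \<Rightarrow> ('a \<Rightarrow> 'a) \<Rightarrow> 'a \<Rightarrow> complex \<Rightarrow> 'a \<times> 'a" where
  "tau_BCL V1 V2 h = (\<lambda>z.
     if z \<in> ball 0 1 then
       (\<Sum>n. z ^ n *\<^sub>C
          (defect_adj V1 ((cadj (V1 \<circ> V2) ^^ n) h),
           defect_adj V2 (cadj V1 ((cadj (V1 \<circ> V2) ^^ n) h))))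
     else 0)"

text \<open>The Hilbert space adjoint of \<open>tau_BCL V1 V2\<close>, viewed as an operator into
  \<open>hardy_space (BCL_space V1 V2)\<close>.\<close>

definition tau_BCL_adj ::
    "('a::chilbert_space \<Rightarrow> 'a) \<Rightarrow> ('a \<Rightarrow> 'a) \<Rightarrow> (complex \<Rightarrow> 'a \<times> 'a) \<Rightarrow> 'a" where
  "tau_BCL_adj V1 V2 =
     (\<lambda>g\<in>hardy_space (BCL_space V1 V2).
        THE h. \<forall>x. hardy_cinner (tau_BCL V1 V2 x) g = cinner x h)"

definition r_unitary ::
    "('a::chilbert_space \<Rightarrow> 'a) \<Rightarrow> ('a \<Rightarrow> 'a) \<Rightarrow> complex \<Rightarrow> 'a \<Rightarrow> 'a" where
  "r_unitary V1 V2 q =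
     tau_BCL_adj V1 V2 \<circ> hardy_rot q (BCL_space V1 V2) \<circ> tau_BCL V1 V2"

end

(*
The adjoint of the BCL unitary is only needed weakly: r_q is the operator with
  <x, r_q h> = sum_n cnj(q)^n <P V*^n x, V*^n h>,   P = I - V V*,
since the n-th Taylor coefficients of tau x and tau h have inner product <P V*^n x, V*^n h>,
a telescoping difference. From this formula r_q V = q V r_q, r_q = I on ker V*, and
r_(cnj q) is both the adjoint and the inverse of r_q.

Both equivalences are instances, (p, s) = (1, q) and (q, cnj q), of: (V1, V2) is doubly
p-commutative iff (V1 r_s, r_(cnj s) V2) is doubly p s-commutative. The first relations of the
two sides are equivalent by conjugating V with r_s. Given V1 V2 = p V2 V1, the second relations
say that V1* r_(cnj s) V2 and V1* V2, respectively, vanish on ker V1*; these agree since V2 maps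
ker V1* into ker V*, where r_(cnj s) is the identity.
*)
theory Submission
  imports Defs
begin

section \<open>Complex Hilbert spaces\<close>

instance chilbert_space \<subseteq> banach ..

lemma scaleC_one [simp]: "1 *\<^sub>C (x::'a::complex_vector) = x"
  using scaleC_of_real[of 1 x] by simp

lemma scaleC_zero_right [simp]: "a *\<^sub>C (0::'a::complex_vector) = 0"
  using scaleC_add_right[of a 0 0] by simp

lemma scaleC_minus_right: "a *\<^sub>C (- x::'a::complex_vector) = - (a *\<^sub>C x)"
  using scaleC_add_right[of a x "- x"] by (simp add: eq_neg_iff_add_eq_0 add.commute)

lemma scaleC_diff_right: "a *\<^sub>C (x - y::'a::complex_vector) = a *\<^sub>C x - a *\<^sub>C y"
  using scaleC_add_right[of a x "- y"] by (simp add: scaleC_minus_right)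

lemma scaleC_eq_iff_unimodular:
  fixes x y :: "'a::complex_vector"
  assumes "norm q = 1"
  shows "q *\<^sub>C x = q *\<^sub>C y \<longleftrightarrow> x = y"
proof
  assume "q *\<^sub>C x = q *\<^sub>C y"
  then have "inverse q *\<^sub>C q *\<^sub>C x = inverse q *\<^sub>C q *\<^sub>C y" by simp
  moreover have "q \<noteq> 0" using assms by auto
  ultimately show "x = y" by (simp add: scaleC_scaleC)
qed simp

section \<open>Complex inner products and the Cauchy-Schwarz inequality\<close>

context
  fixes x y z :: "'a::complex_inner"
begin

lemma cinner_add_right: "cinner x (y + z) = cinner x y + cinner x z"
  using cinner_add_left[of y z x] by (metis cinner_commute complex_cnj_add)

lemma cinner_scaleC_right: "cinner x (a *\<^sub>C y) = cnj a * cinner x y"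
  using cinner_scaleC_left[of a y x] by (metis cinner_commute complex_cnj_mult)

lemma cinner_zero_left [simp]: "cinner 0 y = 0"
  using cinner_add_left[of 0 0 y] by simp

lemma cinner_zero_right [simp]: "cinner y 0 = 0"
  by (subst cinner_commute) (metis cinner_add_left add_cancel_left_left complex_cnj_zero add_0)

lemma cinner_minus_left: "cinner (- x) y = - cinner x y"
  using cinner_add_left[of x "- x" y] cinner_add_left[of 0 0 y]
  by (simp add: eq_neg_iff_add_eq_0 add.commute)

lemma Im_cinner: "Im (cinner x y) = - inner (\<i> *\<^sub>C x) y"
  by (simp add: cinner_scaleC_left flip: Re_cinner)

end

lemma cinner_diff_left: "cinner (x - y) z = cinner x z - cinner y (z::'a::complex_inner)"
  using cinner_add_left[of x "- y" z] by (simp add: cinner_minus_left)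

lemma cinner_diff_right: "cinner x (y - z) = cinner x y - cinner x (z::'a::complex_inner)"
  by (metis cinner_commute cinner_diff_left complex_cnj_diff)

lemma cinner_ext_right:
  fixes y z :: "'a::complex_inner"
  assumes "\<And>x. cinner x y = cinner x z"
  shows "y = z"
proof -
  have "cinner (y - z) (y - z) = 0" using assms by (simp add: cinner_diff_right)
  then show ?thesis by (simp add: cinner_self)
qed

lemma norm_scaleC: "norm (a *\<^sub>C (x::'a::complex_inner)) = norm a * norm x"
proof -
  have "complex_of_real ((norm (a *\<^sub>C x))\<^sup>2) = a * cnj a * complex_of_real ((norm x)\<^sup>2)"
    by (simp add: cinner_scaleC_left cinner_scaleC_right del: of_real_power flip: cinner_self)
  also have "\<dots> = complex_of_real ((norm a * norm x)\<^sup>2)"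
    by (simp add: complex_norm_square[symmetric] power_mult_distrib)
  finally show ?thesis
    by (metis norm_ge_zero mult_nonneg_nonneg of_real_eq_iff power2_eq_imp_eq)
qed

text \<open>Multiplying \<open>x\<close> by a suitable phase makes the inner product real and
  nonnegative, so the real inequality applies.\<close>

lemma complex_Cauchy_Schwarz: "norm (cinner x (y::'a::complex_inner)) \<le> norm x * norm y"
proof (cases "cinner x y = 0")
  case False
  define u where "u = cnj (sgn (cinner x y))"
  have u: "norm u = 1" using False by (simp add: u_def norm_sgn)
  have "cinner (u *\<^sub>C x) y = of_real (norm (cinner x y))"
    using False
    by (simp add: u_def cinner_scaleC_left sgn_eq complex_norm_square[symmetric] mult.commute
        power2_eq_square)
  then have "norm (cinner x y) = inner (u *\<^sub>C x) y"
    by (metis Re_cinner Re_complex_of_real)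
  also have "\<dots> \<le> norm (u *\<^sub>C x) * norm y" by (rule norm_cauchy_schwarz)
  finally show ?thesis by (simp add: norm_scaleC u)
qed simp

section \<open>Bounded functionals and Riesz representation\<close>

lemma bounded_linear_cinner_left: "bounded_linear (\<lambda>x. cinner x (y::'a::complex_inner))"
proof (rule bounded_linear_intro[where K = "norm y"])
  show "cinner (r *\<^sub>R x) y = r *\<^sub>R cinner x y" for r x
    by (simp add: cinner_scaleC_left scaleR_conv_of_real flip: scaleC_of_real)
qed (auto simp: cinner_add_left complex_Cauchy_Schwarz)

text \<open>The representing vector is the minimizer of the functional \<open>J\<close>:
  completeness yields it as the limit of a minimizing sequence, and the vanishing first variation
  there gives the formula.\<close>

lemma riesz_representation_real:
  fixes f :: "'a::{real_inner, complete_space} \<Rightarrow> real"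
  assumes "bounded_linear f"
  shows "\<exists>h. \<forall>x. f x = inner x h"
proof -
  interpret f: bounded_linear f by fact
  define J where "J x = (norm x)\<^sup>2 - 2 * f x" for x
  define m where "m = Inf (range J)"
  obtain K where K: "\<And>x. norm (f x) \<le> norm x * K" using f.bounded by blast
  have "- K\<^sup>2 \<le> J x" for x
  proof -
    have "f x \<le> norm x * K" using K[of x] by simp
    moreover have "0 \<le> (norm x - K)\<^sup>2" by simp
    ultimately show ?thesis by (simp add: J_def power2_diff)
  qed
  then have bdd: "bdd_below (range J)" by (auto simp: bdd_below_def)
  then have m_le: "m \<le> J x" for x by (auto simp: m_def intro: cInf_lower)
  define u where "u n = inverse (real (Suc n))" for n
  have u: "u \<longlonglongrightarrow> 0" unfolding u_def by (rule LIMSEQ_inverse_real_of_nat)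
  have "\<exists>x. J x < m + u n" for n
    using cInf_lessD[of "range J" "m + u n"] by (auto simp: m_def u_def)
  then obtain X where X: "\<And>n. J (X n) < m + u n" by metis
  \<comment> \<open>Parallelogram law: the linear parts of \<open>J\<close> cancel against the
    midpoint, so near-minimizers lie close together.\<close>
  have par: "(norm (x - y))\<^sup>2 \<le> 2 * (J x - m) + 2 * (J y - m)" for x y
  proof -
    have "(norm (x - y))\<^sup>2 = 2 * J x + 2 * J y - 4 * J ((1/2) *\<^sub>R (x + y))"
      unfolding J_def power2_norm_eq_inner
      by (simp add: f.scaleR f.add inner_simps inner_commute algebra_simps)
    with m_le[of "(1/2) *\<^sub>R (x + y)"] show ?thesis by simp
  qed
  have "Cauchy X"
  proof (rule metric_CauchyI)
    fix e :: real assume "e > 0"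
    define E where "E = e\<^sup>2"
    have "E / 4 > 0" using \<open>e > 0\<close> by (simp add: E_def)
    then obtain N where N: "\<And>n. n \<ge> N \<Longrightarrow> u n < E / 4"
      using order_tendstoD(2)[OF u, of "E / 4"] unfolding eventually_sequentially by blast
    have "dist (X i) (X j) < e" if "i \<ge> N" "j \<ge> N" for i j
    proof -
      have "J (X i) - m < E / 4" "J (X j) - m < E / 4"
        using X[of i] X[of j] N[OF that(1)] N[OF that(2)] by linarith+
      then have "(norm (X i - X j))\<^sup>2 < E"
        using par[of "X i" "X j"] by simp
      then show ?thesis
        using \<open>e > 0\<close> by (auto simp: dist_norm E_def intro: power2_less_imp_less)
    qed
    then show "\<exists>N. \<forall>i\<ge>N. \<forall>j\<ge>N. dist (X i) (X j) < e" by blast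
  qed
  then obtain h where h: "X \<longlonglongrightarrow> h" using Cauchy_convergent convergent_def by blast
  have "(\<lambda>n. J (X n)) \<longlonglongrightarrow> J h"
    unfolding J_def by (intro tendsto_intros f.tendsto h)
  moreover have "(\<lambda>n. m + u n) \<longlonglongrightarrow> m + 0"
    by (intro tendsto_intros u)
  ultimately have "J h \<le> m + 0"
    by (rule LIMSEQ_le) (use X less_imp_le in blast)
  then have Jh: "J h \<le> J x" for x using m_le[of x] by simp
  have "f v = inner v h" for v
  proof -
    define c N where "c = inner h v - f v" and "N = (norm v)\<^sup>2"
    \<comment> \<open>The quadratic \<open>2 * t * c + t\<^sup>2 * N\<close> is smallest at
      \<open>- c / N\<close>; the denominator \<open>N + 1\<close> also covers
      \<open>v = 0\<close>.\<close>
    define t where "t = - c / (N + 1)"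
    have N: "N \<ge> 0" by (simp add: N_def)
    have "J (h + t *\<^sub>R v) - J h = 2 * t * c + t\<^sup>2 * N"
      unfolding J_def c_def N_def power2_norm_eq_inner
      by (simp add: f.add f.scaleR inner_simps inner_commute algebra_simps power2_eq_square)
    then have "0 \<le> 2 * t * c + t\<^sup>2 * N" using Jh[of "h + t *\<^sub>R v"] by simp
    then have "0 \<le> (2 * t * c + t\<^sup>2 * N) * (N + 1)\<^sup>2" by (rule mult_nonneg_nonneg) simp
    also have "\<dots> = 2 * c * (t * (N + 1)) * (N + 1) + (t * (N + 1))\<^sup>2 * N"
      by (simp add: algebra_simps power2_eq_square)
    also have "t * (N + 1) = - c" using N by (simp add: t_def)
    finally have "c\<^sup>2 * (N + 2) \<le> 0"
      by (simp add: algebra_simps power2_eq_square)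
    then have "c = 0" using N by (simp add: mult_le_0_iff)
    then show ?thesis by (simp add: c_def inner_commute)
  qed
  then show ?thesis by blast
qed

text \<open>Complex linearity recovers the imaginary part of \<open>f\<close> from its real part at
  \<open>\<i> *\<^sub>C x\<close>, so the real theorem for \<open>Re (f x)\<close> suffices.\<close>

lemma riesz_representation:
  fixes f :: "'a::chilbert_space \<Rightarrow> complex"
  assumes "bounded_clinear f"
  shows "\<exists>h. \<forall>x. f x = cinner x h"
proof -
  have f: "bounded_linear f" and fC: "\<And>c x. f (c *\<^sub>C x) = c * f x"
    using assms by (auto simp: bounded_clinear_def scaleC_complex_def)
  have "bounded_linear (\<lambda>x. Re (f x))"
    using bounded_linear_compose[OF bounded_linear_Re f] by simp
  then obtain h where h: "\<And>x. Re (f x) = inner x h" using riesz_representation_real by blast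
  have "f x = cinner x h" for x
  proof (rule complex_eqI)
    show "Re (f x) = Re (cinner x h)" by (simp add: h Re_cinner)
    show "Im (f x) = Im (cinner x h)" using h[of "\<i> *\<^sub>C x"] by (simp add: fC Im_cinner)
  qed
  then show ?thesis by blast
qed


section \<open>Adjoints\<close>

text \<open>A relational adjoint: symmetric, stable under composition, and enough to identify
  \<open>cadj\<close> by \<open>cadj_eqI\<close> without a separate proof of boundedness.\<close>

definition adjoint_pair :: "('a::chilbert_space \<Rightarrow> 'b::chilbert_space) \<Rightarrow> ('b \<Rightarrow> 'a) \<Rightarrow> bool" where
  "adjoint_pair T S \<longleftrightarrow> (\<forall>x y. cinner (T x) y = cinner x (S y))"

lemma adjoint_pairD: "adjoint_pair T S \<Longrightarrow> cinner (T x) y = cinner x (S y)"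
  by (simp add: adjoint_pair_def)

lemma adjoint_pair_sym: "adjoint_pair T S \<Longrightarrow> adjoint_pair S T"
  unfolding adjoint_pair_def by (metis cinner_commute)

lemma adjoint_pair_comp:
  "adjoint_pair T S \<Longrightarrow> adjoint_pair T' S' \<Longrightarrow> adjoint_pair (T \<circ> T') (S' \<circ> S)"
  by (simp add: adjoint_pair_def)

lemma cadj_eqI:
  assumes "adjoint_pair T S"
  shows "cadj T = S"
proof
  fix y
  show "cadj T y = S y"
    unfolding cadj_def
  proof (rule the_equality)
    show "\<forall>x. cinner (T x) y = cinner x (S y)" using assms by (simp add: adjoint_pair_def)
    show "x' = S y" if "\<forall>x. cinner (T x) y = cinner x x'" for x'
      by (rule cinner_ext_right) (use assms that in \<open>simp add: adjoint_pair_def\<close>)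
  qed
qed

lemma adjoint_pair_cadj:
  assumes "bounded_clinear T"
  shows "adjoint_pair T (cadj T)"
proof -
  have T: "bounded_linear T" "\<And>c x. T (c *\<^sub>C x) = c *\<^sub>C T x"
    using assms by (auto simp: bounded_clinear_def)
  have "\<forall>y. \<exists>h. \<forall>x. cinner (T x) y = cinner x h"
  proof (rule allI, rule riesz_representation)
    fix y
    show "bounded_clinear (\<lambda>x. cinner (T x) y)"
      using bounded_linear_compose[OF bounded_linear_cinner_left T(1)]
      by (simp add: bounded_clinear_def T(2) scaleC_complex_def cinner_scaleC_left)
  qed
  then have "\<exists>S. \<forall>y. \<forall>x. cinner (T x) y = cinner x (S y)" by (rule choice)
  then obtain S where "\<forall>y. \<forall>x. cinner (T x) y = cinner x (S y)" ..
  then have S: "adjoint_pair T S" by (simp add: adjoint_pair_def)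
  show ?thesis unfolding cadj_eqI[OF S] by (rule S)
qed

text \<open>Tested against all vectors, \<open>T\<close> turns into \<open>S\<close> acting on the
  other argument, and only linearity of the inner product remains to be used.\<close>

lemma adjoint_pair_linear:
  assumes "adjoint_pair T S"
  shows "T (x + y) = T x + T y" and "T (x - y) = T x - T y" and "T (c *\<^sub>C x) = c *\<^sub>C T x"
    and "T 0 = 0"
proof -
  note eq = adjoint_pairD[OF adjoint_pair_sym[OF assms], symmetric]
  show "T (x + y) = T x + T y"
    by (rule cinner_ext_right) (simp only: cinner_add_right eq)
  show "T (x - y) = T x - T y"
    by (rule cinner_ext_right) (simp only: cinner_diff_right eq)
  show "T (c *\<^sub>C x) = c *\<^sub>C T x"
    by (rule cinner_ext_right) (simp only: cinner_scaleC_right eq)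
  show "T 0 = 0"
    by (rule cinner_ext_right) (simp only: cinner_zero_right eq)
qed

text \<open>Polarization gives the real part; the imaginary part is, up to sign, the real part at
  \<open>\<i> *\<^sub>C x\<close>.\<close>

lemma isometry_cinner:
  assumes "is_isometry T"
  shows "cinner (T x) (T y) = cinner x y"
proof -
  have T: "bounded_linear T" "\<And>c x. T (c *\<^sub>C x) = c *\<^sub>C T x" "\<And>x. norm (T x) = norm x"
    using assms by (auto simp: is_isometry_def bounded_clinear_def)
  interpret T: bounded_linear T by fact
  have inner_T: "inner (T x) (T y) = inner x y" for x y
    by (simp add: T(3) dot_norm flip: T.add)
  show ?thesis
  proof (rule complex_eqI)
    show "Re (cinner (T x) (T y)) = Re (cinner x y)" by (simp add: Re_cinner inner_T)
    show "Im (cinner (T x) (T y)) = Im (cinner x y)" by (simp add: Im_cinner inner_T flip: T(2))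
  qed
qed

lemma isometry_adjoint_pair: "is_isometry T \<Longrightarrow> adjoint_pair T (cadj T)"
  by (simp add: is_isometry_def adjoint_pair_cadj)

lemma isometry_cadj_inverse:
  assumes "is_isometry T"
  shows "cadj T (T x) = x"
  by (rule cinner_ext_right)
    (simp add: isometry_cinner[OF assms] flip: adjoint_pairD[OF isometry_adjoint_pair[OF assms]])


section \<open>Defect operators\<close>

text \<open>The quadratic form is real. Expanding it at \<open>x + y\<close> yields symmetry of the
  imaginary parts, and replacing \<open>x\<close> by \<open>\<i> *\<^sub>C x\<close> transfers this
  to the real parts.\<close>

lemma positive_operator_adjoint_pair:
  assumes "positive_operator T"
  shows "adjoint_pair T T"
proof -
  have T: "bounded_clinear T" "\<And>x. cinner (T x) x \<in> \<real>\<^sub>\<ge>\<^sub>0"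
    using assms by (auto simp: positive_operator_def)
  interpret T: bounded_linear T using T(1) by (simp add: bounded_clinear_def)
  have TC: "T (c *\<^sub>C x) = c *\<^sub>C T x" for c x using T(1) by (simp add: bounded_clinear_def)
  have im: "Im (cinner (T x) x) = 0" for x
    using T(2)[of x] complex_nonneg_Reals_iff by blast
  have a: "Im (cinner (T x) y) = - Im (cinner (T y) x)" for x y
    using im[of "x + y"] im[of x] im[of y]
    by (simp add: T.add cinner_add_left cinner_add_right)
  have Im: "Im (cinner (T x) y) = Im (cinner x (T y))" for x y
    using a[of x y] cinner_commute[of x "T y"] by simp
  have "cinner (T x) y = cinner x (T y)" for x y
  proof (rule complex_eqI[OF _ Im])
    show "Re (cinner (T x) y) = Re (cinner x (T y))"
      using Im[of "\<i> *\<^sub>C x" y] by (simp add: TC cinner_scaleC_left)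
  qed
  then show ?thesis by (simp add: adjoint_pair_def)
qed

text \<open>Uniqueness of the positive root \<open>Q\<close>: it kills \<open>x - P x\<close>,
  because its square does and it is self-adjoint. On the range of \<open>P\<close> its square is the
  identity, so \<open>y = Q (P x) - P x\<close> satisfies \<open>Q y = - y\<close>, and positivity
  forces \<open>y = 0\<close>.\<close>

lemma operator_sqrt_projection:
  assumes "positive_operator P" "P \<circ> P = P"
  shows "operator_sqrt P = P"
  unfolding operator_sqrt_def
proof (rule the_equality)
  fix Q assume "positive_operator Q \<and> Q \<circ> Q = P"
  then have pos: "positive_operator Q" and QQ: "\<And>x. Q (Q x) = P x" by auto
  note Q = positive_operator_adjoint_pair[OF pos]
  note lin = adjoint_pair_linear[OF Q]
  have PP: "P (P x) = P x" for x using assms(2) by (metis comp_apply)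
  show "Q = P"
  proof
    fix x
    have "Q (x - P x) = 0"
    proof -
      have "Q (Q (x - P x)) = 0"
        by (simp add: lin QQ flip: QQ) (metis PP QQ)
      then have "cinner (Q (x - P x)) (Q (x - P x)) = 0"
        by (simp add: adjoint_pairD[OF Q])
      then show ?thesis by (simp add: cinner_self)
    qed
    then have Qx: "Q x = Q (P x)" by (simp add: lin)
    define y where "y = Q (P x) - P x"
    have "Q y = - y" by (simp add: y_def lin QQ PP)
    then have "- cinner y y \<in> \<real>\<^sub>\<ge>\<^sub>0"
      using pos by (metis positive_operator_def cinner_minus_left)
    then have "y = 0"
      by (simp add: cinner_self complex_nonneg_Reals_iff)
    then show "Q x = P x" using Qx by (simp add: y_def)
  qed
qed (use assms in simp)

text \<open>For an isometry, I - T T* is an orthogonal projection and hence its own positive square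
  root.\<close>

lemma defect_adj_isometry:
  assumes "is_isometry T"
  shows "defect_adj T = (\<lambda>x. x - T (cadj T x))"
  unfolding defect_adj_def
proof (rule operator_sqrt_projection)
  note T = isometry_adjoint_pair[OF assms]
  note lin = adjoint_pair_linear[OF T] adjoint_pair_linear[OF adjoint_pair_sym[OF T]]
  let ?P = "\<lambda>x. x - T (cadj T x)"
  show idem: "?P \<circ> ?P = ?P"
    by (simp add: fun_eq_iff lin isometry_cadj_inverse[OF assms])
  have self: "cinner (?P x) y = cinner x (?P y)" for x y
    by (simp add: cinner_diff_left cinner_diff_right adjoint_pairD[OF T]
        adjoint_pairD[OF adjoint_pair_sym[OF T]])
  have cPP: "cinner (?P x) x = cinner (?P x) (?P x)" for x
    using self[of "?P x" x] idem by (metis comp_apply)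
  have "norm (?P x) \<le> norm x" for x
  proof (cases "?P x = 0")
    case False
    have "(norm (?P x))\<^sup>2 = norm (cinner (?P x) x)"
      by (simp only: cPP cinner_self norm_of_real) simp
    also have "\<dots> \<le> norm (?P x) * norm x" by (rule complex_Cauchy_Schwarz)
    finally show ?thesis using False by (simp add: power2_eq_square)
  qed simp
  moreover have "?P (r *\<^sub>R x) = r *\<^sub>R ?P x" for r x
    by (simp add: lin scaleC_diff_right flip: scaleC_of_real)
  ultimately have "bounded_linear ?P"
    by (intro bounded_linear_intro[where K = 1]) (auto simp: lin)
  then show "positive_operator ?P"
    by (auto simp: positive_operator_def bounded_clinear_def lin scaleC_diff_right cPP cinner_self
        simp del: of_real_power)
qed

text \<open>This difference form is what makes the Taylor coefficients below telescope.\<close>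

lemma defect_cinner:
  assumes "is_isometry T"
  shows "cinner (defect_adj T x) (defect_adj T y) = cinner x y - cinner (cadj T x) (cadj T y)"
proof -
  have "cinner x (T (cadj T y)) = cinner (cadj T x) (cadj T y)" for x y
    using adjoint_pairD[OF adjoint_pair_sym[OF isometry_adjoint_pair[OF assms]]] by simp
  moreover have "cinner (T (cadj T x)) y = cinner (cadj T x) (cadj T y)" for x y
    by (rule adjoint_pairD[OF isometry_adjoint_pair[OF assms]])
  ultimately show ?thesis
    by (simp add: defect_adj_isometry[OF assms] cinner_diff_left cinner_diff_right
        isometry_cadj_inverse[OF assms]
        adjoint_pair_linear(2)[OF adjoint_pair_sym[OF isometry_adjoint_pair[OF assms]]])
qed


section \<open>Power series with vector coefficients\<close>

text \<open>Pairing with a fixed \<open>y\<close> reduces the claim to uniqueness of scalar power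
  series; then \<open>y = a n\<close> is chosen.\<close>

lemma power_series_zero_coeff:
  fixes a :: "nat \<Rightarrow> 'b::chilbert_space"
  assumes "\<And>z. z \<in> ball 0 1 \<Longrightarrow> (\<lambda>n. z ^ n *\<^sub>C a n) sums 0"
  shows "a n = 0"
proof -
  have "cinner (a n) y = 0" for y
  proof -
    define F where "F = Abs_fps (\<lambda>n. cinner (a n) y)"
    have sums: "(\<lambda>n. fps_nth F n * z ^ n) sums 0" if "z \<in> ball 0 1" for z
      using bounded_linear.sums[OF bounded_linear_cinner_left assms[OF that], of y]
      by (simp add: F_def cinner_scaleC_left mult.commute)
    \<comment> \<open>Convergence at the single point 1/2 already gives the positive radius required
      by \<open>eval_fps_eqD\<close>.\<close>
    have "fps_conv_radius F \<ge> norm (1/2 :: complex)"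
      unfolding fps_conv_radius_def
      by (rule conv_radius_geI) (use sums[of "1/2"] in \<open>auto simp: sums_iff\<close>)
    then have "fps_conv_radius F > 0"
      by (rule less_le_trans[rotated]) simp
    moreover have "\<forall>\<^sub>F z in nhds 0. eval_fps F z = eval_fps 0 z"
      by (rule eventually_mono[OF eventually_nhds_in_open[of "ball 0 1"]])
        (use sums in \<open>auto simp: eval_fps_def sums_iff\<close>)
    ultimately have "F = 0" by (intro eval_fps_eqD) auto
    then show ?thesis by (metis F_def fps_nth_Abs_fps fps_zero_nth)
  qed
  from this[of "a n"] show ?thesis by (simp add: cinner_self)
qed

lemma has_taylor_unique:
  assumes "has_taylor f a" "has_taylor f b"
  shows "a = b"
proof
  fix n
  have "(\<lambda>n. z ^ n *\<^sub>C (a n - b n)) sums 0" if "z \<in> ball 0 1" for z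
    using sums_diff[of _ "f z" _ "f z"] assms that
    by (fastforce simp: has_taylor_def scaleC_diff_right)
  then have "a n - b n = 0" by (rule power_series_zero_coeff)
  then show "a n = b n" by simp
qed

lemma hardy_coeff_eq: "has_taylor f a \<Longrightarrow> hardy_coeff f = a"
  unfolding hardy_coeff_def by (rule the_equality) (auto intro: has_taylor_unique)

text \<open>Inside the disk the series converges absolutely, since 2ab \<le> a^2 + b^2 dominates its
  terms by a geometric series plus the squared norms of the coefficients.\<close>

lemma has_taylor_suminf:
  fixes a :: "nat \<Rightarrow> 'b::chilbert_space"
  assumes "summable (\<lambda>n. (norm (a n))\<^sup>2)"
  shows "has_taylor (\<lambda>z. if z \<in> ball 0 1 then \<Sum>n. z ^ n *\<^sub>C a n else 0) a"
proof -
  have "summable (\<lambda>n. z ^ n *\<^sub>C a n)" if z: "norm z < 1" for z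
  proof (rule summable_norm_cancel, rule summable_comparison_test')
    show "summable (\<lambda>n. ((norm z)\<^sup>2) ^ n + (norm (a n))\<^sup>2)"
      using z by (intro summable_add assms summable_geometric) (simp add: abs_square_less_1)
    show "norm (norm (z ^ n *\<^sub>C a n)) \<le> ((norm z)\<^sup>2) ^ n + (norm (a n))\<^sup>2" for n
    proof -
      have "norm (norm (z ^ n *\<^sub>C a n)) = norm z ^ n * norm (a n)"
        by (simp add: norm_scaleC norm_power)
      also have "\<dots> \<le> 2 * (norm z ^ n) * norm (a n)" by simp
      also have "\<dots> \<le> (norm z ^ n)\<^sup>2 + (norm (a n))\<^sup>2" by (rule sum_squares_bound)
      finally show ?thesis by (simp add: power_mult[symmetric] mult.commute)
    qed
  qed
  then show ?thesis by (auto simp: has_taylor_def summable_sums)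
qed

text \<open>Closure of \<open>F\<close> under scalars keeps the rotated function in the Hardy space;
  outside it \<open>tau_BCL_adj\<close> is \<open>undefined\<close>.\<close>

lemma hardy_rot_has_taylor:
  assumes q: "norm q = 1" and F: "\<And>c x. x \<in> F \<Longrightarrow> c *\<^sub>C x \<in> F"
    and f: "f \<in> hardy_space F" and a: "has_taylor f a"
  shows "hardy_rot q F f \<in> hardy_space F"
    and "has_taylor (hardy_rot q F f) (\<lambda>n. q ^ n *\<^sub>C a n)"
proof -
  have ball: "q * z \<in> ball 0 1 \<longleftrightarrow> z \<in> ball 0 1" for z using q by (simp add: norm_mult)
  obtain b where "range b \<subseteq> F" "summable (\<lambda>n. (norm (b n))\<^sup>2)" "has_taylor f b"
    using f by (auto simp: hardy_space_def)
  \<comment> \<open>By uniqueness, the coefficients witnessing membership in the Hardy space are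
    \<open>a\<close> itself.\<close>
  then have rng: "range a \<subseteq> F" and sm: "summable (\<lambda>n. (norm (a n))\<^sup>2)"
    using has_taylor_unique[OF a] by auto
  show tay: "has_taylor (hardy_rot q F f) (\<lambda>n. q ^ n *\<^sub>C a n)"
    unfolding has_taylor_def
  proof
    fix z :: complex assume "z \<in> ball 0 1"
    then have "(\<lambda>n. (q * z) ^ n *\<^sub>C a n) sums f (q * z)"
      using a ball by (auto simp: has_taylor_def)
    then show "(\<lambda>n. z ^ n *\<^sub>C q ^ n *\<^sub>C a n) sums hardy_rot q F f z"
      using f by (simp add: hardy_rot_def scaleC_scaleC power_mult_distrib mult.commute)
  qed
  have "range (\<lambda>n. q ^ n *\<^sub>C a n) \<subseteq> F" using rng F by auto
  moreover have "summable (\<lambda>n. (norm (q ^ n *\<^sub>C a n))\<^sup>2)"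
    using sm by (simp add: norm_scaleC norm_power q)
  moreover have "hardy_rot q F f z = 0" if "z \<notin> ball 0 1" for z
    using f that ball by (auto simp: hardy_rot_def hardy_space_def)
  ultimately show "hardy_rot q F f \<in> hardy_space F"
    using tay by (auto simp: hardy_space_def)
qed


section \<open>The unitary associated with a pair of isometries\<close>

locale isometry_pair =
  fixes V1 V2 :: "'a::chilbert_space \<Rightarrow> 'a"
  assumes iso1: "is_isometry V1" and iso2: "is_isometry V2"
    and shift: "is_shift (V1 \<circ> V2)"
begin

definition V :: "'a \<Rightarrow> 'a" where "V = V1 \<circ> V2"

abbreviation "W \<equiv> cadj V"
abbreviation "r \<equiv> r_unitary V1 V2"
abbreviation "F \<equiv> BCL_space V1 V2"

text \<open>The n-th Taylor coefficient of \<open>tau_BCL V1 V2 h\<close>.\<close>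

definition coef :: "nat \<Rightarrow> 'a \<Rightarrow> 'a \<times> 'a" where
  "coef n h = (defect_adj V1 ((W ^^ n) h), defect_adj V2 (cadj V1 ((W ^^ n) h)))"

lemma isoV: "is_isometry V"
  using shift by (simp add: is_shift_def V_def)

lemma V_apply: "V x = V1 (V2 x)"
  by (simp add: V_def)

lemmas adj1 = isometry_adjoint_pair[OF iso1]
lemmas adj2 = isometry_adjoint_pair[OF iso2]
lemmas adjV = isometry_adjoint_pair[OF isoV]
lemmas lin1 = adjoint_pair_linear[OF adj1] adjoint_pair_linear[OF adjoint_pair_sym[OF adj1]]
lemmas lin2 = adjoint_pair_linear[OF adj2] adjoint_pair_linear[OF adjoint_pair_sym[OF adj2]]

lemma cadj_V: "W = cadj V2 \<circ> cadj V1"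
  unfolding V_def by (rule cadj_eqI) (rule adjoint_pair_comp[OF adj1 adj2])

lemma W_V: "W (V x) = x"
  by (rule isometry_cadj_inverse[OF isoV])

lemma adj_W_power: "adjoint_pair (W ^^ n) (V ^^ n)"
proof (induction n)
  case (Suc n)
  show ?case
    using adjoint_pair_comp[OF adjoint_pair_sym[OF adjV] Suc]
    by (simp add: adjoint_pair_def funpow_swap1)
qed (simp add: adjoint_pair_def)

section \<open>Taylor coefficients and the Hardy space image\<close>

lemma W_power_tendsto: "(\<lambda>n. (W ^^ n) x) \<longlonglongrightarrow> 0"
  using shift by (simp add: is_shift_def V_def)

text \<open>The two defect components contribute two differences; the middle terms, involving
  \<open>cadj V1\<close>, cancel because \<open>W = cadj V2 \<circ> cadj V1\<close>.\<close>

lemma coef_cinner: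
  "cinner (coef n x) (coef n y)
     = cinner ((W ^^ n) x) ((W ^^ n) y) - cinner ((W ^^ Suc n) x) ((W ^^ Suc n) y)"
  by (simp add: coef_def cinner_prod_def defect_cinner iso1 iso2 cadj_V)

text \<open>The boundary term of the telescoping sum tends to 0 by the shift property. In effect,
  \<open>tau_BCL\<close> is isometric.\<close>

lemma coef_cinner_sums: "(\<lambda>n. cinner (coef n x) (coef n y)) sums cinner x y"
proof -
  have "(\<lambda>n. norm ((W ^^ n) x) * norm ((W ^^ n) y)) \<longlonglongrightarrow> 0"
    using tendsto_mult[OF tendsto_norm[OF W_power_tendsto[of x]] tendsto_norm[OF W_power_tendsto[of y]]]
    by simp
  then have "(\<lambda>n. cinner ((W ^^ n) x) ((W ^^ n) y)) \<longlonglongrightarrow> 0"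
    by (rule Lim_null_comparison[rotated]) (simp add: complex_Cauchy_Schwarz)
  then show ?thesis
    using telescope_sums' unfolding coef_cinner by fastforce
qed

lemma coef_norm_sums: "(\<lambda>n. (norm (coef n x))\<^sup>2) sums (norm x)\<^sup>2"
  using sums_Re[OF coef_cinner_sums[of x x]] by (simp only: cinner_self Re_complex_of_real)

text \<open>Scalars commute with the defect operator, so its range is invariant; continuity passes
  this to the closure.\<close>

lemma BCL_space_scaleC:
  assumes "u \<in> F"
  shows "c *\<^sub>C u \<in> F"
proof -
  have closed: "c *\<^sub>C x \<in> defect_space_adj T"
    if T: "is_isometry T" and "x \<in> defect_space_adj T" for x and T :: "'a \<Rightarrow> 'a"
  proof -
    note lin = adjoint_pair_linear[OF isometry_adjoint_pair[OF T]]
      adjoint_pair_linear[OF adjoint_pair_sym[OF isometry_adjoint_pair[OF T]]]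
    have "bounded_linear (\<lambda>x::'a. c *\<^sub>C x)"
    proof (rule bounded_linear_intro[where K = "norm c"])
      show "c *\<^sub>C r *\<^sub>R x = r *\<^sub>R c *\<^sub>C x" for r and x :: 'a
        by (simp add: scaleC_scaleC mult.commute flip: scaleC_of_real)
    qed (auto simp: scaleC_add_right norm_scaleC)
    then have "(\<lambda>x. c *\<^sub>C x) ` closure (range (defect_adj T))
        \<subseteq> closure ((\<lambda>x. c *\<^sub>C x) ` range (defect_adj T))"
      by (intro image_closure_subset closed_closure closure_subset)
        (auto intro: linear_continuous_on)
    moreover have "(\<lambda>x. c *\<^sub>C x) ` range (defect_adj T) \<subseteq> range (defect_adj T)"
      by (auto simp: defect_adj_isometry[OF T] scaleC_diff_right lin[symmetric])
    ultimately show ?thesis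
      using that(2) closure_mono unfolding defect_space_adj_def by blast
  qed
  from assms show ?thesis
    by (auto simp: BCL_space_def scaleC_prod_def intro: closed iso1 iso2)
qed

lemma tau_has_taylor: "has_taylor (tau_BCL V1 V2 h) (\<lambda>n. coef n h)"
  using has_taylor_suminf[OF sums_summable[OF coef_norm_sums[of h]]]
  unfolding tau_BCL_def coef_def V_def .

lemma tau_in_hardy_space: "tau_BCL V1 V2 h \<in> hardy_space F"
proof -
  have "range (\<lambda>n. coef n h) \<subseteq> F"
    unfolding coef_def BCL_space_def defect_space_adj_def
    using closure_subset by (fastforce simp del: closure_subset)
  moreover have "tau_BCL V1 V2 h z = 0" if "z \<notin> ball 0 1" for z
    using that by (simp add: tau_BCL_def)
  ultimately show ?thesis
    using tau_has_taylor[of h] sums_summable[OF coef_norm_sums[of h]]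
    unfolding hardy_space_def by blast
qed

section \<open>The weak formula for the rotation unitary\<close>

lemma rotated_coef_summable:
  assumes "norm q = 1"
  shows "summable (\<lambda>n. norm (cnj q ^ n * cinner (coef n x) (coef n h)))"
    and "norm (\<Sum>n. cnj q ^ n * cinner (coef n x) (coef n h)) \<le> ((norm x)\<^sup>2 + (norm h)\<^sup>2) / 2"
proof -
  have sums: "(\<lambda>n. ((norm (coef n x))\<^sup>2 + (norm (coef n h))\<^sup>2) / 2)
      sums (((norm x)\<^sup>2 + (norm h)\<^sup>2) / 2)"
    by (intro sums_divide sums_add coef_norm_sums)
  have le: "norm (cnj q ^ n * cinner (coef n x) (coef n h))
      \<le> ((norm (coef n x))\<^sup>2 + (norm (coef n h))\<^sup>2) / 2" for n
    using complex_Cauchy_Schwarz[of "coef n x" "coef n h"]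
      sum_squares_bound[of "norm (coef n x)" "norm (coef n h)"]
    by (simp add: norm_mult norm_power assms)
  show sm: "summable (\<lambda>n. norm (cnj q ^ n * cinner (coef n x) (coef n h)))"
    by (rule summable_comparison_test'[OF sums_summable[OF sums]]) (use le in simp)
  have "norm (\<Sum>n. cnj q ^ n * cinner (coef n x) (coef n h))
      \<le> (\<Sum>n. norm (cnj q ^ n * cinner (coef n x) (coef n h)))"
    by (rule summable_norm[OF sm])
  also have "\<dots> \<le> (\<Sum>n. ((norm (coef n x))\<^sup>2 + (norm (coef n h))\<^sup>2) / 2)"
    by (rule suminf_le[OF le sm sums_summable[OF sums]])
  also have "\<dots> = ((norm x)\<^sup>2 + (norm h)\<^sup>2) / 2" using sums by (simp add: sums_iff)
  finally show "norm (\<Sum>n. cnj q ^ n * cinner (coef n x) (coef n h))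
      \<le> ((norm x)\<^sup>2 + (norm h)\<^sup>2) / 2" .
qed

text \<open>The definite description in \<open>tau_BCL_adj\<close> needs an existing representing
  vector. The series is a bounded linear functional of \<open>x\<close>, so Riesz representation
  supplies one.\<close>

lemma r_cinner_sums:
  assumes q: "norm q = 1"
  shows "(\<lambda>n. cnj q ^ n * cinner (coef n x) (coef n h)) sums cinner x (r q h)"
proof -
  define f where "f x = (\<Sum>n. cnj q ^ n * cinner (coef n x) (coef n h))" for x
  note sm = summable_norm_cancel[OF rotated_coef_summable(1)[OF q]]
  note lin = adjoint_pair_linear[OF adj_W_power]
  have f_add: "f (x + y) = f x + f y" for x y
    unfolding f_def suminf_add[OF sm sm]
    by (rule arg_cong[where f = suminf])
      (simp add: fun_eq_iff coef_cinner lin cinner_add_left algebra_simps del: funpow.simps)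
  have f_scale: "f (c *\<^sub>C x) = c * f x" for c x
    unfolding f_def suminf_mult[OF sm, symmetric]
    by (rule arg_cong[where f = suminf])
      (simp add: fun_eq_iff coef_cinner lin cinner_scaleC_left algebra_simps del: funpow.simps)
  have "bounded_linear f"
  \<comment> \<open>The bound from \<open>rotated_coef_summable\<close> is quadratic in
    \<open>norm x\<close>; taken at the unit vector \<open>sgn x\<close> it gives this constant, and
    homogeneity makes it linear.\<close>
  proof (rule bounded_linear_intro[where K = "(1 + (norm h)\<^sup>2) / 2"])
    show f_real: "f (r *\<^sub>R x) = r *\<^sub>R f x" for r x
      by (metis f_scale scaleC_of_real scaleR_conv_of_real)
    show "norm (f x) \<le> norm x * ((1 + (norm h)\<^sup>2) / 2)" for x
    proof (cases "x = 0")
      case True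
      then show ?thesis using f_real[of 0 x] by simp
    next
      case False
      have "norm (f (sgn x)) \<le> (1 + (norm h)\<^sup>2) / 2"
        using rotated_coef_summable(2)[OF q, of "sgn x" h] False by (simp add: f_def norm_sgn)
      moreover have "f x = norm x *\<^sub>R f (sgn x)"
        using False by (simp add: sgn_div_norm flip: f_real)
      ultimately show ?thesis
        by (metis mult_left_mono norm_ge_zero norm_scaleR abs_norm_cancel)
    qed
  qed (rule f_add)
  then have "bounded_clinear f" by (simp add: bounded_clinear_def f_scale scaleC_complex_def)
  then obtain k where k: "\<And>x. f x = cinner x k" using riesz_representation by blast
  define g where "g = hardy_rot q F (tau_BCL V1 V2 h)"
  note rot = hardy_rot_has_taylor[OF q BCL_space_scaleC tau_in_hardy_space tau_has_taylor, of h]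
  have "hardy_cinner (tau_BCL V1 V2 x) g = f x" for x
    by (simp add: hardy_cinner_def f_def g_def hardy_coeff_eq[OF tau_has_taylor]
        hardy_coeff_eq[OF rot(2)] cinner_scaleC_right)
  then have "r q h = (THE k. \<forall>x. f x = cinner x k)"
    using rot(1) by (simp add: r_unitary_def tau_BCL_adj_def g_def[symmetric])
  also have "\<dots> = k"
    by (rule the_equality) (use k in \<open>metis cinner_ext_right\<close>)+
  finally have "f x = cinner x (r q h)" using k by simp
  then show ?thesis using summable_sums[OF sm, of x h] by (simp add: f_def)
qed

section \<open>Algebraic relations of the rotation unitary\<close>

lemma r_adjoint:
  assumes "norm q = 1"
  shows "adjoint_pair (r q) (r (cnj q))"
proof -
  have "cinner (r q x) y = cinner x (r (cnj q) y)" for x y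
  proof -
    \<comment> \<open>Termwise conjugation exchanges the arguments and replaces \<open>q\<close> by
      \<open>cnj q\<close>.\<close>
    have "(\<lambda>n. cnj (cnj q ^ n * cinner (coef n y) (coef n x))) sums cnj (cinner y (r q x))"
      using r_cinner_sums[OF assms] by (simp only: sums_cnj)
    then have "(\<lambda>n. cnj (cnj q) ^ n * cinner (coef n x) (coef n y)) sums cinner (r q x) y"
      by (simp flip: cinner_commute)
    moreover have "(\<lambda>n. cnj (cnj q) ^ n * cinner (coef n x) (coef n y))
        sums cinner x (r (cnj q) y)"
      using assms by (intro r_cinner_sums) simp
    ultimately show ?thesis by (rule sums_unique2)
  qed
  then show ?thesis by (simp add: adjoint_pair_def)
qed

text \<open>An index shift: coefficient n + 1 of \<open>V h\<close> pairs with that of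
  \<open>x\<close> as coefficient n of \<open>h\<close> pairs with that of \<open>W x\<close>. The
  zeroth term vanishes since \<open>W (V h) = h\<close>, and one factor \<open>cnj q\<close> comes
  out.\<close>

lemma r_V:
  assumes "norm q = 1"
  shows "r q (V h) = q *\<^sub>C V (r q h)"
proof (rule cinner_ext_right)
  fix x
  have "(\<lambda>n. cnj q ^ Suc n * cinner (coef (Suc n) x) (coef (Suc n) (V h)))
      sums (cnj q * cinner (W x) (r q h))"
    using sums_mult[OF r_cinner_sums[OF assms, of "W x" h], of "cnj q"]
    by (simp add: coef_cinner funpow_swap1 W_V mult.assoc)
  moreover have "cinner (coef 0 x) (coef 0 (V h)) = 0"
    by (simp add: coef_cinner W_V adjoint_pairD[OF adjoint_pair_sym[OF adjV]])
  ultimately have "(\<lambda>n. cnj q ^ n * cinner (coef n x) (coef n (V h)))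
      sums (cnj q * cinner (W x) (r q h))"
    by (subst (asm) sums_Suc_iff) simp
  then have "cinner x (r q (V h)) = cnj q * cinner (W x) (r q h)"
    using r_cinner_sums[OF assms] sums_unique2 by blast
  then show "cinner x (r q (V h)) = cinner x (q *\<^sub>C V (r q h))"
    by (simp add: cinner_scaleC_right adjoint_pairD[OF adjoint_pair_sym[OF adjV]])
qed

text \<open>Only the zeroth coefficient of such an \<open>h\<close> survives, so its image under
  \<open>tau_BCL\<close> is constant on the disk and rotation fixes it.\<close>

lemma r_kernel:
  assumes "norm q = 1" and "W h = 0"
  shows "r q h = h"
proof (rule cinner_ext_right)
  fix x
  have "(W ^^ Suc n) h = 0" for n
    by (induction n) (auto simp: assms(2) adjoint_pair_linear(4)[OF adjoint_pair_sym[OF adjV]])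
  then have "coef (Suc n) h = 0" for n
    using coef_cinner[of "Suc n" h h] by (simp add: cinner_self del: funpow.simps)
  then have "(\<lambda>n. cnj q ^ n * cinner (coef n x) (coef n h)) sums cinner (coef 0 x) (coef 0 h)"
    using sums_finite[of "{0}" "\<lambda>n. cnj q ^ n * cinner (coef n x) (coef n h)"]
    by (simp add: gr0_conv_Suc) (metis cinner_zero_right mult_zero_right not0_implies_Suc)
  also have "cinner (coef 0 x) (coef 0 h) = cinner x h" by (simp add: coef_cinner assms(2))
  finally show "cinner x (r q h) = cinner x h"
    using r_cinner_sums[OF assms(1)] sums_unique2 by blast
qed

text \<open>Against \<open>coef n x\<close>, the n-th coefficient of \<open>r q h\<close> acts as
  \<open>q ^ n\<close> times that of \<open>h\<close>. Rotation by \<open>cnj q\<close> cancels this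
  factor, leaving the series for \<open>cinner x h\<close>.\<close>

lemma r_inverse:
  assumes "norm q = 1"
  shows "r (cnj q) (r q h) = h"
proof (rule cinner_ext_right)
  fix x
  have q': "norm (cnj q) = 1" using assms by simp
  have qq: "q * cnj q = 1" using assms by (simp add: complex_norm_square[symmetric])
  have lin: "r q (c *\<^sub>C x) = c *\<^sub>C r q x" for c x
    by (rule adjoint_pair_linear[OF r_adjoint[OF assms]])
  \<comment> \<open>The adjoint form of \<open>r_V\<close>, applied with
    \<open>cnj q\<close>.\<close>
  have W_r: "W (r q y) = q *\<^sub>C r q (W y)" for y
  proof (rule cinner_ext_right)
    fix z
    have "cinner z (W (r q y)) = cinner (r (cnj q) (V z)) y"
      using adjoint_pairD[OF adjV, of z "r q y"] adjoint_pairD[OF r_adjoint[OF q']] by simp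
    also have "\<dots> = cnj q * cinner (V (r (cnj q) z)) y"
      by (simp only: r_V[OF q'] cinner_scaleC_left)
    also have "\<dots> = cinner z (q *\<^sub>C r q (W y))"
      using adjoint_pairD[OF adjV] adjoint_pairD[OF r_adjoint[OF q']]
      by (simp add: cinner_scaleC_right)
    finally show "cinner z (W (r q y)) = cinner z (q *\<^sub>C r q (W y))" .
  qed
  have W_pow: "(W ^^ n) (r q y) = q ^ n *\<^sub>C r q ((W ^^ n) y)" for n y
  proof (induction n)
    case (Suc n)
    then show ?case
      by (simp add: W_r scaleC_scaleC mult.commute
          adjoint_pair_linear(3)[OF adjoint_pair_sym[OF adjV]])
  qed simp
  have qn: "cnj q ^ n * q ^ n = 1" for n
    using qq by (simp add: mult.commute flip: power_mult_distrib)
  have key: "cinner (coef n x) (coef n (r q h)) = cnj q ^ n * cinner (coef n x) (coef n h)" for n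
  proof -
    define y z where "y = (W ^^ n) x" and "z = (W ^^ n) h"
    \<comment> \<open>With the defect projection moved onto \<open>y\<close>, \<open>r q\<close>
      passes to the left argument as \<open>r (cnj q)\<close>, where it meets a vector in the kernel
      of \<open>W\<close> and fixes it.\<close>
    have P: "cinner a b - cinner (W a) (W b) = cinner (a - V (W a)) b" for a b
      by (simp only: cinner_diff_left adjoint_pairD[OF adjV])
    have "W (y - V (W y)) = 0"
      using adjoint_pair_linear(2)[OF adjoint_pair_sym[OF adjV]] W_V by simp
    then have k: "r (cnj q) (y - V (W y)) = y - V (W y)" by (rule r_kernel[OF q'])
    have "cinner (coef n x) (coef n (r q h)) = cinner (y - V (W y)) (q ^ n *\<^sub>C r q z)"
      unfolding P[symmetric] coef_cinner by (simp add: W_pow y_def z_def)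
    also have "\<dots> = cnj q ^ n * cinner (y - V (W y)) z"
      using adjoint_pairD[OF r_adjoint[OF q'], of "y - V (W y)" z] k
      by (simp add: cinner_scaleC_right)
    also have "cinner (y - V (W y)) z = cinner (coef n x) (coef n h)"
      unfolding P[symmetric] coef_cinner by (simp add: y_def z_def)
    finally show ?thesis .
  qed
  have "(\<lambda>n. cinner (coef n x) (coef n h)) sums cinner x (r (cnj q) (r q h))"
    using r_cinner_sums[OF q', of x "r q h"] qn
    by (simp add: key mult.assoc[symmetric] mult.commute)
  then show "cinner x (r (cnj q) (r q h)) = cinner x h"
    using coef_cinner_sums sums_unique2 by blast
qed

section \<open>Twisting a pair of isometries by a rotation\<close>

proposition doubly_q_commutative_twist:
  assumes p: "norm p = 1" and s: "norm s = 1"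
  shows "doubly_q_commutative p V1 V2
     \<longleftrightarrow> doubly_q_commutative (p * s) (V1 \<circ> r s) (r (cnj s) \<circ> V2)"
proof -
  define R R' where "R = r s" and "R' = r (cnj s)"
  have s': "norm (cnj s) = 1" using s by simp
  have ss: "s * cnj s = 1" and pp: "p * cnj p = 1"
    using s p by (simp_all add: complex_norm_square[symmetric])
  have R'R: "R' (R x) = x" and RR': "R (R' x) = x" for x
    using r_inverse[OF s] r_inverse[OF s'] by (simp_all add: R_def R'_def)
  have adjR: "adjoint_pair R R'" using r_adjoint[OF s] by (simp add: R_def R'_def)
  note linR = adjoint_pair_linear[OF adjR] adjoint_pair_linear[OF adjoint_pair_sym[OF adjR]]
  have RV: "R (V1 (V2 x)) = s *\<^sub>C V1 (V2 (R x))" for x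
    using r_V[OF s] by (simp add: R_def V_apply)
  have R'V: "V1 (V2 (R' x)) = s *\<^sub>C R' (V1 (V2 x))" for x
    using r_V[OF s'] by (simp add: R'_def V_apply scaleC_scaleC ss)
  have cadj_A: "cadj (V1 \<circ> R) = R' \<circ> cadj V1"
    by (rule cadj_eqI) (rule adjoint_pair_comp[OF adj1 adjR])
  have ps: "norm (p * s) = 1" by (simp add: norm_mult p s)
  have R'_inj: "R' x = R' y \<longleftrightarrow> x = y" for x y by (metis RR')
  have comm: "(\<forall>x. V1 (V2 x) = p *\<^sub>C V2 (V1 x))
      \<longleftrightarrow> (\<forall>x. V1 (V2 x) = (p * s) *\<^sub>C R' (V2 (V1 (R x))))"
  proof -
    \<comment> \<open>Substituting \<open>x = R' y\<close>, which reaches every vector, lets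
      \<open>R'V\<close> pull the injective map s R' out of both sides.\<close>
    have "V1 (V2 (R' y)) = (p * s) *\<^sub>C R' (V2 (V1 (R (R' y))))
        \<longleftrightarrow> V1 (V2 y) = p *\<^sub>C V2 (V1 y)" for y
    proof -
      have "(p * s) *\<^sub>C R' (V2 (V1 y)) = s *\<^sub>C R' (p *\<^sub>C V2 (V1 y))"
        by (simp add: linR scaleC_scaleC mult.commute)
      then show ?thesis
        by (simp add: RR' R'V scaleC_eq_iff_unimodular[OF s] R'_inj)
    qed
    then show ?thesis by (metis R'R)
  qed
  have dual: "(\<forall>x. V2 (cadj V1 x) = p *\<^sub>C cadj V1 (V2 x))
      \<longleftrightarrow> (\<forall>x. R' (V2 (R' (cadj V1 x))) = (p * s) *\<^sub>C R' (cadj V1 (R' (V2 x))))"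
    if com: "\<And>x. V1 (V2 x) = p *\<^sub>C V2 (V1 x)"
  proof -
    have com': "V2 (V1 x) = cnj p *\<^sub>C V1 (V2 x)" for x
      using pp by (simp add: com scaleC_scaleC mult.commute)
    \<comment> \<open>Taking the adjoint of V = p V2 V1 puts \<open>cadj V2\<close> innermost, so
      \<open>W (V2 w)\<close> reduces to a multiple of \<open>cadj V1 w\<close>.\<close>
    have W_eq: "W = (\<lambda>x. cnj p *\<^sub>C cadj V1 (cadj V2 x))"
    proof (rule cadj_eqI)
      show "adjoint_pair V (\<lambda>x. cnj p *\<^sub>C cadj V1 (cadj V2 x))"
        unfolding adjoint_pair_def
        using adjoint_pairD[OF adj1] adjoint_pairD[OF adj2]
        by (simp add: V_apply com cinner_scaleC_left cinner_scaleC_right)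
    qed
    have "V2 (cadj V1 x) = p *\<^sub>C cadj V1 (V2 x)
        \<longleftrightarrow> R' (V2 (R' (cadj V1 x))) = (p * s) *\<^sub>C R' (cadj V1 (R' (V2 x)))" for x
    proof -
      \<comment> \<open>The component of \<open>x\<close> in the kernel of \<open>cadj V1\<close>;
        the rest is \<open>V1 (cadj V1 x)\<close>.\<close>
      define w where "w = x - V1 (cadj V1 x)"
      have w0: "cadj V1 w = 0" by (simp add: w_def lin1 isometry_cadj_inverse[OF iso1])
      have "W (V2 w) = 0"
        by (simp add: W_eq isometry_cadj_inverse[OF iso2] w0)
      then have fixw: "R' (V2 w) = V2 w" using r_kernel[OF s'] by (simp add: R'_def)
      \<comment> \<open>Up to the outer \<open>R'\<close>, the left side of the twisted relation at
        \<open>x\<close> is its right side at \<open>V1 (cadj V1 x)\<close>, so the relation is a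
        condition on \<open>w\<close> alone.\<close>
      have "V2 (R' (cadj V1 x)) = cadj V1 (V1 (V2 (R' (cadj V1 x))))"
        by (simp add: isometry_cadj_inverse[OF iso1])
      also have "\<dots> = (p * s) *\<^sub>C cadj V1 (R' (V2 (V1 (cadj V1 x))))"
        by (simp add: R'V com[of "cadj V1 x"] linR lin1 scaleC_scaleC mult.commute)
      finally have "R' (V2 (R' (cadj V1 x))) = (p * s) *\<^sub>C R' (cadj V1 (R' (V2 x)))
          \<longleftrightarrow> (p * s) *\<^sub>C cadj V1 (R' (V2 (V1 (cadj V1 x)))) = (p * s) *\<^sub>C cadj V1 (R' (V2 x))"
        by (simp add: R'_inj flip: linR)
      also have "\<dots> \<longleftrightarrow> cadj V1 (R' (V2 w)) = 0"
        by (auto simp: scaleC_eq_iff_unimodular[OF ps] w_def lin1 lin2 linR)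
      \<comment> \<open>Here \<open>fixw\<close> removes the rotation; \<open>com'\<close> then
        turns the condition into the untwisted relation.\<close>
      also have "\<dots> \<longleftrightarrow> cadj V1 (V2 x) = cadj V1 (V2 (V1 (cadj V1 x)))"
        unfolding fixw by (auto simp: w_def lin1 lin2)
      also have "cadj V1 (V2 (V1 (cadj V1 x))) = cnj p *\<^sub>C V2 (cadj V1 x)"
        by (simp add: com' lin1 isometry_cadj_inverse[OF iso1])
      also have "cadj V1 (V2 x) = cnj p *\<^sub>C V2 (cadj V1 x)
          \<longleftrightarrow> V2 (cadj V1 x) = p *\<^sub>C cadj V1 (V2 x)"
        using pp by (auto simp: scaleC_scaleC mult.commute)
      finally show ?thesis by simp
    qed
    then show ?thesis by simp
  qed
  \<comment> \<open>In the product of the twisted operators the inner rotations cancel, leaving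
    \<open>V1 (V2 x)\<close>.\<close>
  have "doubly_q_commutative (p * s) (V1 \<circ> R) (R' \<circ> V2) \<longleftrightarrow>
      (\<forall>x. V1 (V2 x) = (p * s) *\<^sub>C R' (V2 (V1 (R x)))) \<and>
      (\<forall>x. R' (V2 (R' (cadj V1 x))) = (p * s) *\<^sub>C R' (cadj V1 (R' (V2 x))))"
    by (simp add: doubly_q_commutative_def q_commutative_def cadj_A RR')
  then show ?thesis
    unfolding R_def[symmetric] R'_def[symmetric] doubly_q_commutative_def[of p] q_commutative_def
    using comm dual by metis
qed

end

lemma doubly_commutative_iff: "doubly_commutative A B \<longleftrightarrow> doubly_q_commutative 1 A B"
  by (auto simp: doubly_commutative_def doubly_q_commutative_def q_commutative_def fun_eq_iff)

theorem theorem3p3: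
  fixes V1 V2 :: "'a::chilbert_space \<Rightarrow> 'a" and q :: complex
  assumes "norm q = 1"
    and "is_isometry V1" and "is_isometry V2"
    and "is_shift (V1 \<circ> V2)"
  shows "(doubly_commutative V1 V2 \<longleftrightarrow>
            doubly_q_commutative q (V1 \<circ> r_unitary V1 V2 q) (r_unitary V1 V2 (cnj q) \<circ> V2))
       \<and> (doubly_q_commutative q V1 V2 \<longleftrightarrow>
            doubly_commutative (V1 \<circ> r_unitary V1 V2 (cnj q)) (r_unitary V1 V2 q \<circ> V2))"
proof -
  interpret isometry_pair V1 V2 by unfold_locales fact+
  have "q * cnj q = 1" using assms(1) by (simp add: complex_norm_square[symmetric])
  then show ?thesis
    using doubly_q_commutative_twist[of 1 q] doubly_q_commutative_twist[of q "cnj q"] assms(1)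
    by (simp add: doubly_commutative_iff)
qed

end
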